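(* For a function $f$ on $[-1,1]$ let $a_n^L=(n+\tfrac12)\int_{-1}^1f(x)P_n(x)\,dx$ and $a_n^C=\frac{2}{\pi}\int_{-1}^1\frac{f(x)T_n(x)}{\sqrt{1-x^2}}dx$ be its Legendre and Chebyshev coefficients, and let $\gamma_n=a_n^L/a_n^C$ (whenever $a_n^C\ne0$). (i) If $f(x)=(1+x)^\alpha$ or $f(x)=(1-x)^\alpha$, where $\operatorname{Re}(\alpha)>-\tfrac12$ and $\alpha$ is not an integer, then \[ \gamma_n=\frac{\Gamma(\alpha+1)}{\Gamma(\alpha+\frac12)}\sqrt\pi+\mathcal{O}(n^{-1}),\qquad n\to\infty. \] (ii) If $f(x)=\log(1+x)$ or $f(x)=\log(1-x)$, then \[ \gamma_n=1+\mathcal{O}(n^{-1}),\qquad n\to\infty. \]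
   Context: $P_n$ is the Legendre polynomial and $T_n$ the Chebyshev polynomial of the first kind of degree $n$. *)

theory Defs
  imports "HOL-Analysis.Analysis" "HOL-Library.Landau_Symbols"
begin

text \<open>Legendre polynomials P_n, via Bonnet's recurrence
  (n+2) P_{n+2} = (2n+3) x P_{n+1} - (n+1) P_n.\<close>
fun legendreP :: "nat \<Rightarrow> real \<Rightarrow> real" where
  "legendreP 0 x = 1"
| "legendreP (Suc 0) x = x"
| "legendreP (Suc (Suc n)) x =
     ((2 * real n + 3) * x * legendreP (Suc n) x - (real n + 1) * legendreP n x) / (real n + 2)"

fun chebyshevT :: "nat \<Rightarrow> real \<Rightarrow> real" where
  "chebyshevT 0 x = 1"
| "chebyshevT (Suc 0) x = x"
| "chebyshevT (Suc (Suc n)) x = 2 * x * chebyshevT (Suc n) x - chebyshevT n x"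

definition legendre_coeff :: "(real \<Rightarrow> complex) \<Rightarrow> nat \<Rightarrow> complex" where
  "legendre_coeff f n =
     complex_of_real (real n + 1/2) *
       (LINT x:{-1..1}|lborel. f x * complex_of_real (legendreP n x))"

definition cheb_coeff :: "(real \<Rightarrow> complex) \<Rightarrow> nat \<Rightarrow> complex" where
  "cheb_coeff f n =
     complex_of_real (2 / pi) *
       (LINT x:{-1..1}|lborel. f x * complex_of_real (chebyshevT n x) / complex_of_real (sqrt (1 - x\<^sup>2)))"

definition gamma_ratio :: "(real \<Rightarrow> complex) \<Rightarrow> nat \<Rightarrow> complex" where
  "gamma_ratio f n = legendre_coeff f n / cheb_coeff f n"

end

theory Submission
  imports Defs "HOL-Complex_Analysis.Conformal_Mappings"
begin

text \<open>
  After reflecting \<open>x \<mapsto> -x\<close> if necessary, only powers and logarithms of \<open>1 - x\<close> matter.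
  Substituting \<open>x = 1 - 2t\<close> turns both kinds of coefficients into integrals
  \<open>J(s) = \<integral> t\<^sup>s\<^sup>-\<^sup>1 (1 - t)\<^sup>c\<^sup>-\<^sup>1 p(t) dt\<close> over the unit interval, with \<open>c = 1\<close> for Legendre and
  \<open>c = 1/2\<close> for Chebyshev. Multiplying \<open>p\<close> by \<open>1 - 2t\<close> replaces \<open>J(s)\<close> by \<open>J(s) - 2 J(s + 1)\<close>, so
  the three-term recurrences of the polynomials determine \<open>J\<close> for all \<open>s\<close> by induction on the degree,
  starting from the Beta integral. The closed forms give exactly
  \<open>\<gamma>\<^sub>n = \<Gamma>(\<alpha> + 1) / \<Gamma>(\<alpha> + 1/2) \<cdot> \<surd>\<pi> \<cdot> (n + 1/2) / (n + \<alpha> + 1)\<close>. The logarithm is the derivative of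
  the power at \<open>\<alpha> = 0\<close>, where the closed forms have a simple zero; its ratio is
  \<open>(n + 1/2) / (n + 1)\<close>.
\<close>

section \<open>The kernel with a Jacobi weight and its integrability\<close>

definition jacobi_kernel :: "real \<Rightarrow> (real \<Rightarrow> real) \<Rightarrow> complex \<Rightarrow> real \<Rightarrow> complex" where
  "jacobi_kernel c p s t =
     of_real t powr (s - 1) * of_real ((1 - t) powr (c - 1)) * of_real (p t)"

definition jacobi_integral :: "real \<Rightarrow> (real \<Rightarrow> real) \<Rightarrow> complex \<Rightarrow> complex" where
  "jacobi_integral c p s = (LINT t:{0..1}|lborel. jacobi_kernel c p s t)"

lemma borel_measurable_jacobi_kernel [measurable]:
  assumes [measurable]: "p \<in> borel_measurable borel"
  shows "jacobi_kernel c p s \<in> borel_measurable borel"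
  unfolding jacobi_kernel_def powr_def[where 'a=complex] by measurable

lemma norm_jacobi_kernel:
  assumes "0 \<le> t"
  shows "norm (jacobi_kernel c p s t) = t powr (Re s - 1) * (1 - t) powr (c - 1) * \<bar>p t\<bar>"
  using assms by (simp add: jacobi_kernel_def norm_mult norm_powr_real_powr)

lemma bounded_continuous_01:
  fixes p :: "real \<Rightarrow> real"
  assumes "continuous_on UNIV p"
  obtains B where "B > 0" "\<And>t. t \<in> {0..1} \<Longrightarrow> \<bar>p t\<bar> \<le> B"
proof -
  have "compact (p ` {0..1})"
    using assms by (intro compact_continuous_image) (auto intro: continuous_on_subset)
  then obtain B where "B > 0" "\<forall>x\<in>p ` {0..1}. norm x \<le> B"
    using compact_imp_bounded bounded_pos by blast
  then show ?thesis
    using that by auto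
qed

lemma set_integrable_bound_Beta:
  fixes f :: "real \<Rightarrow> complex"
  assumes "a > 0" "c > 0" and [measurable]: "f \<in> borel_measurable borel"
    and bound: "\<And>t. t \<in> {0..1} \<Longrightarrow> norm (f t) \<le> B * (t powr (a - 1) * (1 - t) powr (c - 1))"
  shows "set_integrable lborel {0..1} f"
proof (rule set_integrable_bound)
  show "set_integrable lborel {0..1} (\<lambda>t. B * (t powr (a - 1) * (1 - t) powr (c - 1)))"
    using integrable_Beta[OF assms(1,2)] by simp
  show "set_borel_measurable lborel {0..1} f"
    unfolding set_borel_measurable_def by measurable
  show "AE t in lborel. t \<in> {0..1} \<longrightarrow>
          norm (f t) \<le> norm (B * (t powr (a - 1) * (1 - t) powr (c - 1)))"
    using bound by (auto intro: order_trans[OF _ abs_ge_self])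
qed

lemma set_integrable_jacobi_kernel:
  assumes "c > 0" "Re s > 0" and p: "continuous_on UNIV p"
  shows "set_integrable lborel {0..1} (jacobi_kernel c p s)"
proof -
  have [measurable]: "p \<in> borel_measurable borel"
    using p by (rule borel_measurable_continuous_onI)
  obtain B where "B > 0" "\<And>t. t \<in> {0..1} \<Longrightarrow> \<bar>p t\<bar> \<le> B"
    using bounded_continuous_01[OF p] by blast
  then have "norm (jacobi_kernel c p s t) \<le> B * (t powr (Re s - 1) * (1 - t) powr (c - 1))"
    if "t \<in> {0..1}" for t
    using that by (simp add: norm_jacobi_kernel mult.commute[of B] mult_left_mono)
  then show ?thesis
    using assms by (intro set_integrable_bound_Beta[of "Re s" c]) auto
qed

section \<open>Differentiation under the integral sign with respect to \<open>s\<close>\<close>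

lemma norm_exp_minus_1_le: "norm (exp z - 1) \<le> norm z * exp (norm z)" for z :: complex
proof -
  have "norm (exp z - 1) \<le> exp \<bar>Re z\<bar> * norm z"
    using Taylor_exp[of z 0] by simp
  also have "\<dots> \<le> exp (norm z) * norm z"
    using abs_Re_le_cmod[of z] by (intro mult_right_mono) auto
  finally show ?thesis by (simp add: mult.commute)
qed

text \<open>This is \<open>ln y \<le> y - 1\<close> at \<open>y = t powr (- d)\<close>. A
  logarithmic singularity at 0 thus costs only an arbitrarily small power of
  \<open>t\<close>.\<close>

lemma abs_ln_le_powr:
  fixes t d :: real
  assumes "0 < t" "t \<le> 1" "d > 0"
  shows "\<bar>ln t\<bar> \<le> t powr (- d) / d"
proof -
  have "ln (t powr (- d)) \<le> t powr (- d) - 1"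
    using assms by (intro ln_le_minus_one) auto
  then show ?thesis
    using assms by (simp add: ln_powr field_simps)
qed

lemma set_integrable_jacobi_kernel_ln:
  assumes "c > 0" "Re s > 0" and p: "continuous_on UNIV p"
  shows "set_integrable lborel {0..1} (\<lambda>t. jacobi_kernel c p s t * of_real (ln t))"
proof -
  \<comment> \<open>Half of the exponent pays for the logarithm; the other half leaves
    \<open>t powr (d - 1)\<close> with \<open>d > 0\<close>, which is still integrable at 0.\<close>
  define d where "d = Re s / 2"
  have d: "d > 0" "Re s = 2 * d" using assms by (auto simp: d_def)
  have [measurable]: "p \<in> borel_measurable borel"
    using p by (rule borel_measurable_continuous_onI)
  obtain B where B: "B > 0" "\<And>t. t \<in> {0..1} \<Longrightarrow> \<bar>p t\<bar> \<le> B"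
    using bounded_continuous_01[OF p] by blast
  have "norm (jacobi_kernel c p s t * of_real (ln t)) \<le> B / d * (t powr (d - 1) * (1 - t) powr (c - 1))"
    if t: "t \<in> {0..1}" for t
  proof (cases "t = 0")
    case False
    have "norm (jacobi_kernel c p s t * of_real (ln t))
        \<le> (t powr (Re s - 1) * (1 - t) powr (c - 1) * B) * (t powr (- d) / d)"
      using t False B d abs_ln_le_powr[of t d] unfolding norm_mult
      by (intro mult_mono) (auto simp: norm_jacobi_kernel intro!: mult_left_mono)
    also have "\<dots> = B / d * ((t powr (Re s - 1) * t powr (- d)) * (1 - t) powr (c - 1))"
      by simp
    also have "t powr (Re s - 1) * t powr (- d) = t powr (d - 1)"
      unfolding powr_add[symmetric] d(2) by simp
    finally show ?thesis .
  \<comment> \<open>At \<open>t = 0\<close> the kernel vanishes, because \<open>0 powr z = 0\<close>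
    for every exponent.\<close>
  qed (use B d in \<open>auto simp: jacobi_kernel_def\<close>)
  then show ?thesis
    using assms d by (intro set_integrable_bound_Beta[of d c _ "B / d"]) auto
qed

text \<open>For \<open>t > 0\<close> this is the addition law of exponents. At \<open>t = 0\<close>
  both sides are 0 by the convention \<open>0 powr z = 0\<close>, whatever value \<open>ln 0\<close>
  has.\<close>

lemma jacobi_kernel_add:
  assumes "t \<ge> 0"
  shows "jacobi_kernel c p (s + h) t = jacobi_kernel c p s t * exp (h * of_real (ln t))"
proof (cases "t = 0")
  case False
  have "of_real t powr (s + h - 1) = of_real t powr (s - 1) * of_real t powr h"
    unfolding powr_add[symmetric] by (simp add: algebra_simps)
  then show ?thesis
    using assms False by (simp add: jacobi_kernel_def powr_def[of _ h] Ln_of_real)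
qed (simp add: jacobi_kernel_def)

text \<open>The \<open>s\<close>-derivative of the kernel is the kernel times \<open>ln t\<close>.
  Dominated convergence, applied to the difference quotients \<open>Q h\<close>, lets the limit pass
  through the integral.\<close>

lemma has_field_derivative_jacobi_integral:
  assumes c: "c > 0" and s: "Re s > 0" and p: "continuous_on UNIV p"
  shows "(jacobi_integral c p has_field_derivative
           (LINT t:{0..1}|lborel. jacobi_kernel c p s t * of_real (ln t))) (at s)"
proof -
  define d where "d = Re s / 2"
  have d: "d > 0" "Re s = 2 * d" using s by (auto simp: d_def)
  have [measurable]: "p \<in> borel_measurable borel"
    using p by (rule borel_measurable_continuous_onI)
  define L where "L = (\<lambda>t. jacobi_kernel c p s t * complex_of_real (ln t))"
  \<comment> \<open>The dominating function. For \<open>norm h < d\<close>, the quotient of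
    \<open>exp (h * ln t) - 1\<close> by \<open>h\<close> is at most
    \<open>\<bar>ln t\<bar> * exp (d * \<bar>ln t\<bar>)\<close> in norm. On the unit interval the
    exponential factor is \<open>t powr (- d)\<close>, so it moves \<open>s\<close> to
    \<open>s - d\<close>, whose real part \<open>d\<close> is still positive.\<close>
  define w where "w = (\<lambda>t. norm (jacobi_kernel c p (s - of_real d) t * complex_of_real (ln t)))"
  define Q where "Q = (\<lambda>h t. (jacobi_kernel c p (s + h) t - jacobi_kernel c p s t) / h)"
  have w: "set_integrable lborel {0..1} w"
    unfolding w_def using d c p by (intro set_integrable_norm set_integrable_jacobi_kernel_ln) auto
  have Q_eq: "Q h t = jacobi_kernel c p s t * ((exp (h * of_real (ln t)) - 1) / h)" if "t \<ge> 0" for h t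
    using that by (simp add: Q_def jacobi_kernel_add right_diff_distrib diff_divide_distrib)
  have bound: "norm (Q h t) \<le> w t" if t: "t \<in> {0..1}" and h: "h \<noteq> 0" "norm h < d" for h t
  proof -
    have "norm (exp (h * of_real (ln t)) - 1) \<le> norm h * \<bar>ln t\<bar> * exp (norm h * \<bar>ln t\<bar>)"
      using norm_exp_minus_1_le[of "h * of_real (ln t)"] by (simp add: norm_mult)
    also have "\<dots> \<le> norm h * \<bar>ln t\<bar> * exp (d * \<bar>ln t\<bar>)"
      using h by (intro mult_left_mono) (auto intro!: mult_right_mono)
    finally have "norm ((exp (h * of_real (ln t)) - 1) / h) \<le> \<bar>ln t\<bar> * exp (d * \<bar>ln t\<bar>)"
      using h by (simp add: norm_divide field_simps)
    then have "norm (Q h t) \<le> norm (jacobi_kernel c p s t) * (\<bar>ln t\<bar> * exp (d * \<bar>ln t\<bar>))"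
      using t by (simp only: Q_eq norm_mult atLeastAtMost_iff mult_left_mono norm_ge_zero)
    also have "\<dots> = w t"
    proof (cases "t = 0")
      case False
      then have "exp (d * \<bar>ln t\<bar>) = norm (exp (- of_real d * complex_of_real (ln t)))"
        using t by simp
      then show ?thesis
        using t jacobi_kernel_add[of t c p s "- of_real d"] by (simp add: w_def norm_mult)
    qed (simp add: w_def jacobi_kernel_def)
    finally show ?thesis .
  qed
  have lim: "(\<lambda>i. Q (X i) t) \<longlonglongrightarrow> L t"
    if X: "\<And>i. X i \<noteq> 0" "X \<longlonglongrightarrow> 0" and t: "t \<in> {0..1}" for X :: "nat \<Rightarrow> complex" and t
  proof -
    have "((\<lambda>h. exp (h * complex_of_real (ln t))) has_field_derivative of_real (ln t)) (at 0)"
      by (auto intro!: derivative_eq_intros)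
    then have "((\<lambda>h. (exp (h * complex_of_real (ln t)) - 1) / h) \<longlongrightarrow> of_real (ln t)) (at 0)"
      by (simp add: DERIV_def)
    moreover have "filterlim X (at 0) sequentially"
      using X by (simp add: filterlim_at)
    ultimately have "(\<lambda>i. (exp (X i * complex_of_real (ln t)) - 1) / X i) \<longlonglongrightarrow> of_real (ln t)"
      by (rule filterlim_compose)
    then show ?thesis
      using t unfolding L_def by (simp only: Q_eq atLeastAtMost_iff tendsto_mult_left)
  qed
  \<comment> \<open>Dominated convergence is a statement about sequences. Restricting to the ball
    makes the bound by \<open>w\<close> valid for every term of the sequence, not just eventually;
    as the ball is open, the restriction is dropped afterwards.\<close>
  have "((\<lambda>h. LINT t:{0..1}|lborel. Q h t) \<longlongrightarrow> (LINT t:{0..1}|lborel. L t)) (at 0 within ball 0 d)"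
    unfolding tendsto_at_iff_sequentially
  proof (intro allI impI)
    fix X :: "nat \<Rightarrow> complex"
    assume X: "\<forall>i. X i \<in> ball 0 d - {0}" "X \<longlonglongrightarrow> 0"
    show "((\<lambda>h. LINT t:{0..1}|lborel. Q h t) \<circ> X) \<longlonglongrightarrow> (LINT t:{0..1}|lborel. L t)"
      unfolding set_lebesgue_integral_def comp_def
    proof (rule integral_dominated_convergence[where w = "\<lambda>t. indicator {0..1} t * w t"])
      show "integrable lborel (\<lambda>t. indicat_real {0..1} t * w t)"
        using w by (simp add: set_integrable_def)
      show "AE t in lborel. (\<lambda>i. indicat_real {0..1} t *\<^sub>R Q (X i) t) \<longlonglongrightarrow> indicat_real {0..1} t *\<^sub>R L t"
        using lim[of X] X by (auto simp: indicator_def)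
      show "AE t in lborel. norm (indicat_real {0..1} t *\<^sub>R Q (X i) t) \<le> indicat_real {0..1} t * w t" for i
        using bound[of _ "X i"] X by (auto simp: indicator_def)
    qed (unfold L_def Q_def, measurable)
  qed
  then have "((\<lambda>h. LINT t:{0..1}|lborel. Q h t) \<longlongrightarrow> (LINT t:{0..1}|lborel. L t)) (at 0)"
    using d by (simp add: at_within_open[of 0 "ball 0 d"])
  moreover have "eventually (\<lambda>h. (LINT t:{0..1}|lborel. Q h t) =
      (jacobi_integral c p (s + h) - jacobi_integral c p s) / h) (at 0)"
  proof -
    have "eventually (\<lambda>h. h \<in> ball 0 d - {0}) (at (0::complex))"
      using d by (intro eventually_at_in_open) auto
    then show ?thesis
    proof eventually_elim
      case (elim h)
      then have "Re (s + h) > 0"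
        using d abs_Re_le_cmod[of h] by auto
      then show ?case
        using set_integrable_jacobi_kernel[OF c _ p] s by (simp add: Q_def jacobi_integral_def)
    qed
  qed
  ultimately show ?thesis
    unfolding DERIV_def L_def by (rule Lim_transform_eventually)
qed

section \<open>The Beta integral for complex \<open>s\<close>\<close>

lemma jacobi_integral_one_real:
  assumes "c > 0" "a > 0"
  shows "jacobi_integral c (\<lambda>_. 1) (of_real a) = of_real (Beta a c)"
proof -
  have "jacobi_integral c (\<lambda>_. 1) (of_real a) =
      (LINT t:{0..1}|lborel. complex_of_real (t powr (a - 1) * (1 - t) powr (c - 1)))"
    unfolding jacobi_integral_def
    using powr_of_real[of _ "a - 1"]
    by (intro set_lebesgue_integral_cong) (auto simp: jacobi_kernel_def)
  also have "\<dots> = of_real (LINT t:{0..1}|lborel. t powr (a - 1) * (1 - t) powr (c - 1))"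
    by (rule set_integral_complex_of_real)
  also have "(LINT t:{0..1}|lborel. t powr (a - 1) * (1 - t) powr (c - 1)) = Beta a c"
    using set_borel_integral_eq_integral(2)[OF integrable_Beta[OF assms(2,1)]]
      integral_unique[OF has_integral_Beta_real[OF assms(2,1)]] by simp
  finally show ?thesis .
qed

text \<open>The library has the Beta integral for real arguments only; both sides are holomorphic in \<open>s\<close>.\<close>

lemma jacobi_integral_one:
  assumes c: "c > 0" and s: "Re s > 0"
  shows "jacobi_integral c (\<lambda>_. 1) s = Beta s (of_real c)"
proof -
  define S where "S = {z. Re z > 0}"
  define U where "U = complex_of_real ` {0<..}"
  have op: "open S" unfolding S_def by (rule open_halfspace_Re_gt)
  have hol: "(\<lambda>z. jacobi_integral c (\<lambda>_. 1) z - Beta z (of_real c)) holomorphic_on S"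
  proof (rule holomorphic_on_diff)
    show "jacobi_integral c (\<lambda>_. 1) holomorphic_on S"
      using has_field_derivative_jacobi_integral[OF c, of _ "\<lambda>_. 1"] op
      by (auto simp: holomorphic_on_open S_def)
    have *: "z \<notin> \<int>\<^sub>\<le>\<^sub>0" if "Re z > 0" for z :: complex
      using that by (auto elim!: nonpos_Ints_cases)
    show "(\<lambda>z. Beta z (complex_of_real c)) holomorphic_on S"
      unfolding Beta_def using c
      by (intro holomorphic_intros) (auto simp: S_def Gamma_eq_zero_iff intro!: *)
  qed
  have conn: "connected S"
    unfolding S_def by (intro convex_connected convex_halfspace_Re_gt)
  have lim: "1 islimpt U"
    unfolding islimpt_approachable
  proof (intro allI impI)
    fix e :: real assume "e > 0"
    have "dist (complex_of_real (1 + e / 2)) (of_real 1) = e / 2"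
      unfolding dist_of_real using \<open>e > 0\<close> by (simp add: dist_real_def)
    then have "dist (complex_of_real (1 + e / 2)) 1 = e / 2"
      by (simp only: of_real_1)
    then show "\<exists>z\<in>U. z \<noteq> 1 \<and> dist z 1 < e"
      using \<open>e > 0\<close> by (intro bexI[of _ "complex_of_real (1 + e / 2)"]) (auto simp: U_def simp del: of_real_add)
  qed
  have U: "U \<subseteq> S" "1 \<in> S" by (auto simp: U_def S_def)
  have zero: "jacobi_integral c (\<lambda>_. 1) z - Beta z (of_real c) = 0" if "z \<in> U" for z
    using that c by (auto simp: U_def jacobi_integral_one_real Beta_complex_of_real)
  have "jacobi_integral c (\<lambda>_. 1) s - Beta s (of_real c) = 0"
    by (rule analytic_continuation[OF hol op conn U lim zero]) (use s in \<open>simp_all add: S_def\<close>)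
  then show ?thesis by simp
qed

section \<open>Closed forms from the three-term recurrences\<close>

text \<open>An extra factor \<open>t\<close> in the kernel is a shift of \<open>s\<close> by 1. The
  combination of \<open>p\<close> and \<open>q\<close> has the shape of the right-hand side of both
  polynomial recurrences at \<open>x = 1 - 2 * t\<close>.\<close>

lemma jacobi_integral_linear:
  assumes "c > 0" "Re s > 0" "continuous_on UNIV p" "continuous_on UNIV q"
  shows "jacobi_integral c (\<lambda>t. u * (1 - 2 * t) * p t - v * q t) s =
    of_real u * (jacobi_integral c p s - 2 * jacobi_integral c p (s + 1)) - of_real v * jacobi_integral c q s"
proof -
  have s1: "Re (s + 1) > 0" using assms by simp
  note [simp] = set_integrable_jacobi_kernel[OF assms(1) _ assms(3)] set_integrable_jacobi_kernel[OF assms(1) _ assms(4)]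
  have "jacobi_kernel c (\<lambda>t. u * (1 - 2 * t) * p t - v * q t) s t =
     of_real u * (jacobi_kernel c p s t - 2 * jacobi_kernel c p (s + 1) t) - of_real v * jacobi_kernel c q s t" for t
    using powr_add[of "of_real t" "s - 1" 1]
    by (simp add: jacobi_kernel_def algebra_simps)
  then have "jacobi_integral c (\<lambda>t. u * (1 - 2 * t) * p t - v * q t) s =
    (LINT t:{0..1}|lborel. of_real u * (jacobi_kernel c p s t - 2 * jacobi_kernel c p (s + 1) t) - of_real v * jacobi_kernel c q s t)"
    by (simp add: jacobi_integral_def)
  also have "\<dots> = of_real u * (jacobi_integral c p s - 2 * jacobi_integral c p (s + 1)) - of_real v * jacobi_integral c q s"
    using assms s1 by (simp add: set_integral_diff jacobi_integral_def)
  finally show ?thesis .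
qed


lemma jacobi_integral_1_minus_2t:
  assumes "c > 0" "Re s > 0"
  shows "jacobi_integral c (\<lambda>t. 1 - 2 * t) s = Beta s (of_real c) - 2 * Beta (s + 1) (of_real c)"
  using jacobi_integral_linear[of c s "\<lambda>_. 1" "\<lambda>_. 1" 1 0] assms
  by (simp add: jacobi_integral_one)

lemma continuous_on_legendreP [continuous_intros]:
  "continuous_on A f \<Longrightarrow> continuous_on A (\<lambda>t. legendreP n (f t))"
  by (induction n rule: induct_nat_012) (auto intro!: continuous_intros)

lemma continuous_on_chebyshevT [continuous_intros]:
  "continuous_on A f \<Longrightarrow> continuous_on A (\<lambda>t. chebyshevT n (f t))"
  by (induction n rule: induct_nat_012) (auto intro!: continuous_intros)

lemma pochhammer_nonzero: "Re s > 0 \<Longrightarrow> pochhammer s n \<noteq> 0" for s :: complex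
  using pochhammer_eq_0_iff[of s n] by auto

text \<open>Both sides are \<open>pochhammer s (Suc n)\<close>, split at its first and at its last
  factor. This expresses symbols starting at \<open>s + 1\<close> through symbols starting at
  \<open>s\<close>.\<close>

lemma pochhammer_shift:
  "s * pochhammer (s + 1) n = pochhammer s n * (s + of_nat n)" for s :: "'a :: comm_semiring_1"
  by (metis pochhammer_Suc pochhammer_rec)

lemma Re_pos_not_nonpos_Int: "Re s > 0 \<Longrightarrow> s \<notin> \<int>\<^sub>\<le>\<^sub>0"
  by (auto elim!: nonpos_Ints_cases)

lemma Beta_one_right: "Re s > 0 \<Longrightarrow> Beta s 1 = 1 / s" for s :: complex
  using Gamma_plus1[of s] Gamma_eq_zero_iff[of s] Re_pos_not_nonpos_Int[of s]
  by (auto simp: Beta_def)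

lemma Beta_plus_one_left:
  "Re s > 0 \<Longrightarrow> b \<ge> 0 \<Longrightarrow> Beta (s + 1) (of_real b) = s / (s + of_real b) * Beta s (of_real b)" for s :: complex
  using Gamma_plus1[of s] Gamma_plus1[of "s + of_real b"] Re_pos_not_nonpos_Int[of s]
    Re_pos_not_nonpos_Int[of "s + of_real b"]
  by (simp add: Beta_def add_ac)

text \<open>Induction with \<open>s\<close> arbitrary, since the recurrence at \<open>s\<close>
  refers to degree \<open>Suc n\<close> at \<open>s + 1\<close> as well. The zeros at
  \<open>s = 1, ..., n\<close> express the orthogonality of the Legendre polynomial to lower powers
  of \<open>t\<close>.\<close>

lemma jacobi_integral_legendreP:
  assumes "Re s > 0"
  shows "jacobi_integral 1 (\<lambda>t. legendreP n (1 - 2 * t)) s = pochhammer (1 - s) n / pochhammer s (Suc n)"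
  using assms
proof (induction n arbitrary: s rule: induct_nat_012)
  case (0 s)
  then show ?case
    by (simp add: jacobi_integral_one Beta_one_right)
next
  case (1 s)
  then have "s \<noteq> 0" "s + 1 \<noteq> 0" by (auto simp: complex_eq_iff)
  then show ?case
    using 1 jacobi_integral_1_minus_2t[of 1 s]
    by (simp add: Beta_one_right pochhammer_Suc field_simps)
next
  case (ge2 n s)
  define A where "A = (\<lambda>n. jacobi_integral 1 (\<lambda>t. legendreP n (1 - 2 * t)))"
  define u v where "u = (2 * real n + 3) / (real n + 2)" and "v = (real n + 1) / (real n + 2)"
  \<comment> \<open>Each value in the recurrence becomes \<open>X / Y\<close> times a rational
    function of \<open>N\<close> and \<open>s\<close>, so the induction step reduces to a field
    identity.\<close>
  define X Y where "X = pochhammer (1 - s) n" and "Y = pochhammer s (Suc n)"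
  define N :: complex where "N = of_nat n"
  have Y: "Y \<noteq> 0" unfolding Y_def using ge2 by (intro pochhammer_nonzero)
  have nz: "s \<noteq> 0" "N + s + 1 \<noteq> 0" "N + s + 2 \<noteq> 0" "N + 2 \<noteq> 0"
    using ge2(3) by (auto simp: complex_eq_iff N_def)
  have A0: "A n s = X / Y" using ge2 by (simp add: A_def X_def Y_def)
  have A1: "A (Suc n) s = X * (N - s + 1) / (Y * (N + s + 1))"
    using ge2 by (simp add: A_def X_def Y_def N_def pochhammer_Suc algebra_simps)
  \<comment> \<open>For the value at \<open>s + 1\<close>, the numerator starts at
    \<open>1 - (s + 1) = - s\<close>, and splitting off this factor leaves \<open>X\<close>.\<close>
  have "pochhammer (- s) (Suc n) = - s * X"
    by (simp add: pochhammer_rec X_def)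
  moreover have "s * pochhammer (s + 1) (Suc (Suc n)) = Y * (N + s + 1) * (N + s + 2)"
    unfolding pochhammer_shift by (simp add: Y_def N_def pochhammer_Suc algebra_simps)
  then have "pochhammer (s + 1) (Suc (Suc n)) = Y * (N + s + 1) * (N + s + 2) / s"
    using nz by (simp add: field_simps)
  ultimately have A1': "A (Suc n) (s + 1) = - s\<^sup>2 * X / (Y * (N + s + 1) * (N + s + 2))"
    using ge2 by (simp add: A_def power2_eq_square)
  have "(\<lambda>t. legendreP (Suc (Suc n)) (1 - 2 * t)) =
      (\<lambda>t. u * (1 - 2 * t) * legendreP (Suc n) (1 - 2 * t) - v * legendreP n (1 - 2 * t))"
    by (simp add: u_def v_def diff_divide_distrib)
  then have "A (Suc (Suc n)) s = of_real u * (A (Suc n) s - 2 * A (Suc n) (s + 1)) - of_real v * A n s"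
    unfolding A_def using ge2(3)
    by (simp only:) (intro jacobi_integral_linear, auto intro!: continuous_intros)
  also have "of_real u = (2 * N + 3) / (N + 2)"
    by (simp add: u_def N_def)
  also have "of_real v = (N + 1) / (N + 2)"
    by (simp add: v_def N_def)
  also have "(2 * N + 3) / (N + 2) * (A (Suc n) s - 2 * A (Suc n) (s + 1)) - (N + 1) / (N + 2) * A n s =
      X * (N - s + 1) * (N - s + 2) / (Y * (N + s + 1) * (N + s + 2))"
    unfolding A0 A1 A1' using nz Y
    by (simp add: divide_simps) (simp add: algebra_simps power2_eq_square)
  also have "\<dots> = pochhammer (1 - s) (Suc (Suc n)) / pochhammer s (Suc (Suc (Suc n)))"
    by (simp add: X_def Y_def N_def pochhammer_Suc algebra_simps)
  finally show ?case unfolding A_def .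
qed

text \<open>The same induction as for Legendre, except that the Beta factor also moves under
  \<open>s \<mapsto> s + 1\<close>, contributing \<open>s / (s + 1/2)\<close>. The zeros at
  \<open>s = 1/2, ..., n - 1/2\<close> express orthogonality with respect to the Chebyshev
  weight.\<close>

lemma jacobi_integral_chebyshevT:
  assumes "Re s > 0"
  shows "jacobi_integral (1/2) (\<lambda>t. chebyshevT n (1 - 2 * t)) s =
           Beta s (1/2) * (pochhammer (1/2 - s) n / pochhammer (s + 1/2) n)"
  using assms
proof (induction n arbitrary: s rule: induct_nat_012)
  case (0 s)
  then show ?case
    using jacobi_integral_one[of "1/2" s] by simp
next
  case (1 s)
  define w where "w = s + 1/2"
  have "w \<noteq> 0" using 1 by (auto simp: complex_eq_iff w_def)
  have "Beta (s + 1) (1/2) = s / w * Beta s (1/2)"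
    using Beta_plus_one_left[of s "1/2"] 1 by (simp add: w_def)
  then have "jacobi_integral (1/2) (\<lambda>t. 1 - 2 * t) s = Beta s (1/2) - 2 * (s / w * Beta s (1/2))"
    using jacobi_integral_1_minus_2t[of "1/2" s] 1 by simp
  also have "\<dots> = Beta s (1/2) * ((w - 2 * s) / w)"
    using \<open>w \<noteq> 0\<close> by (simp add: field_simps)
  also have "w - 2 * s = 1/2 - s"
    by (simp add: w_def)
  finally show ?case
    by (simp add: w_def)
next
  case (ge2 n s)
  define B where "B = (\<lambda>n. jacobi_integral (1/2) (\<lambda>t. chebyshevT n (1 - 2 * t)))"
  define X Y where "X = pochhammer (1/2 - s) n" and "Y = pochhammer (s + 1/2) n"
  define b where "b = Beta s (1/2)"
  define N :: complex where "N = of_nat n"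
  have Y: "Y \<noteq> 0" unfolding Y_def using ge2 by (intro pochhammer_nonzero) auto
  have nz: "s + 1/2 \<noteq> 0" "N + s + 1/2 \<noteq> 0" "N + s + 3/2 \<noteq> 0"
    using ge2(3) by (auto simp: complex_eq_iff N_def)
  have B0: "B n s = b * X / Y" using ge2 by (simp add: B_def X_def Y_def b_def)
  have B1: "B (Suc n) s = b * X * (N - s + 1/2) / (Y * (N + s + 1/2))"
    using ge2 by (simp add: B_def X_def Y_def N_def b_def pochhammer_Suc algebra_simps)
  have "pochhammer (1/2 - (s + 1)) (Suc n) = - (s + 1/2) * X"
    by (simp add: pochhammer_rec X_def algebra_simps)
  moreover have "(s + 1/2) * pochhammer (s + 1/2 + 1) (Suc n) = Y * (N + s + 1/2) * (N + s + 3/2)"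
    unfolding pochhammer_shift by (simp add: Y_def N_def pochhammer_Suc algebra_simps)
  then have "pochhammer (s + 1 + 1/2) (Suc n) = Y * (N + s + 1/2) * (N + s + 3/2) / (s + 1/2)"
    using nz(1) by (metis add.assoc add.commute nonzero_mult_div_cancel_left)
  moreover have "Beta (s + 1) (1/2) = s / (s + 1/2) * b"
    using Beta_plus_one_left[of s "1/2"] ge2 by (simp add: b_def)
  ultimately have "B (Suc n) (s + 1) = s * (b * ((- s - 1/2) * X)) / (Y * (N + s + 1/2) * (N + s + 3/2))"
    using ge2(2)[of "s + 1"] ge2(3) nz by (simp add: B_def)
  also have "s * (b * ((- s - 1/2) * X)) = - b * s * (s + 1/2) * X"
    by (simp add: algebra_simps)
  finally have B1': "B (Suc n) (s + 1) = - b * s * (s + 1/2) * X / (Y * (N + s + 1/2) * (N + s + 3/2))" .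
  have "(\<lambda>t. chebyshevT (Suc (Suc n)) (1 - 2 * t)) =
      (\<lambda>t. 2 * (1 - 2 * t) * chebyshevT (Suc n) (1 - 2 * t) - 1 * chebyshevT n (1 - 2 * t))"
    by simp
  then have "B (Suc (Suc n)) s = of_real 2 * (B (Suc n) s - 2 * B (Suc n) (s + 1)) - of_real 1 * B n s"
    unfolding B_def using ge2(3)
    by (simp only:) (intro jacobi_integral_linear, auto intro!: continuous_intros)
  also have "\<dots> = b * (X * (N - s + 1/2) * (N - s + 3/2) / (Y * (N + s + 1/2) * (N + s + 3/2)))"
    unfolding B0 B1 B1' using nz Y
    by (simp add: divide_simps) (simp add: algebra_simps power2_eq_square)
  also have "\<dots> = b * (pochhammer (1/2 - s) (Suc (Suc n)) / pochhammer (s + 1/2) (Suc (Suc n)))"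
    by (simp add: X_def Y_def N_def pochhammer_Suc algebra_simps)
  finally show ?case unfolding B_def b_def .
qed

text \<open>The end points must be excluded: \<open>0 powr 0 = 0\<close>, so the kernel drops its trivial factors there.\<close>

lemma set_integral_cong_01:
  fixes f g :: "real \<Rightarrow> complex"
  assumes "\<And>t. 0 < t \<Longrightarrow> t < 1 \<Longrightarrow> f t = g t"
  shows "(LINT t:{0..1}|lborel. f t) = (LINT t:{0..1}|lborel. g t)"
  unfolding set_lebesgue_integral_def
  by (rule integral_discrete_difference[of "{0, 1}"]) (use assms in \<open>auto simp: indicator_def\<close>)

section \<open>Affine substitutions and reflection\<close>

lemma set_integral_subst_1_minus_2t:
  fixes g :: "real \<Rightarrow> complex"
  shows "(LINT x:{-1..1}|lborel. g x) = 2 * (LINT t:{0..1}|lborel. g (1 - 2 * t))"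
proof -
  have "(LINT x:{-1..1}|lborel. g x) =
      2 *\<^sub>R (LINT t|lborel. indicat_real {-1..1} (1 - 2 * t) *\<^sub>R g (1 - 2 * t))"
    unfolding set_lebesgue_integral_def
    by (subst lborel_integral_real_affine[where c = "-2" and t = 1]) auto
  also have "(\<lambda>t::real. indicat_real {-1..1} (1 - 2 * t)) = indicator {0..1}"
    by (auto simp: indicator_def)
  finally show ?thesis
    by (simp add: set_lebesgue_integral_def scaleR_conv_of_real)
qed

lemma set_integral_reflect_symmetric:
  fixes g :: "real \<Rightarrow> complex"
  shows "(LINT x:{-1..1}|lborel. g (- x)) = (LINT x:{-1..1}|lborel. g x)"
proof -
  have "(LINT x:{-1..1}|lborel. g x) = (LINT x|lborel. indicat_real {-1..1} (- x) *\<^sub>R g (- x))"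
    unfolding set_lebesgue_integral_def
    by (subst lborel_integral_real_affine[where c = "-1" and t = 0]) auto
  also have "(\<lambda>x::real. indicat_real {-1..1} (- x)) = indicator {-1..1}"
    by (auto simp: indicator_def)
  finally show ?thesis
    by (simp add: set_lebesgue_integral_def)
qed

lemma legendreP_minus: "legendreP n (- x) = (-1) ^ n * legendreP n x"
  by (induction n rule: induct_nat_012) (simp_all add: algebra_simps)

lemma chebyshevT_minus: "chebyshevT n (- x) = (-1) ^ n * chebyshevT n x"
  by (induction n rule: induct_nat_012) (simp_all add: algebra_simps)

lemma legendre_coeff_reflect: "legendre_coeff (\<lambda>x. f (- x)) n = (-1) ^ n * legendre_coeff f n"
proof -
  define g where "g = (\<lambda>x. f x * complex_of_real (legendreP n x))"
  have "f (- x) * complex_of_real (legendreP n x) = (-1) ^ n * g (- x)" for x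
    by (simp add: g_def legendreP_minus mult_ac flip: mult.assoc[of "(-1) ^ n"] power_mult_distrib)
  then have "legendre_coeff (\<lambda>x. f (- x)) n =
      of_real (real n + 1/2) * (LINT x:{-1..1}|lborel. (-1) ^ n * g (- x))"
    by (simp add: legendre_coeff_def)
  also have "\<dots> = (-1) ^ n * (of_real (real n + 1/2) * (LINT x:{-1..1}|lborel. g x))"
    using set_integral_reflect_symmetric[of g] by simp
  finally show ?thesis by (simp add: legendre_coeff_def g_def)
qed

lemma cheb_coeff_reflect: "cheb_coeff (\<lambda>x. f (- x)) n = (-1) ^ n * cheb_coeff f n"
proof -
  define g where "g = (\<lambda>x. f x * complex_of_real (chebyshevT n x) / complex_of_real (sqrt (1 - x\<^sup>2)))"
  have "f (- x) * complex_of_real (chebyshevT n x) / complex_of_real (sqrt (1 - x\<^sup>2)) = (-1) ^ n * g (- x)" for x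
    by (simp add: g_def chebyshevT_minus flip: mult.assoc power_mult_distrib)
  then have "cheb_coeff (\<lambda>x. f (- x)) n = of_real (2 / pi) * (LINT x:{-1..1}|lborel. (-1) ^ n * g (- x))"
    by (simp add: cheb_coeff_def)
  also have "\<dots> = (-1) ^ n * (of_real (2 / pi) * (LINT x:{-1..1}|lborel. g x))"
    using set_integral_reflect_symmetric[of g] by simp
  finally show ?thesis by (simp add: cheb_coeff_def g_def)
qed

text \<open>Both coefficients acquire the same sign \<open>(-1) ^ n\<close>, which cancels.
  Functions of \<open>1 + x\<close> are thereby reduced to functions of
  \<open>1 - x\<close>.\<close>

lemma gamma_ratio_reflect: "gamma_ratio (\<lambda>x. f (- x)) n = gamma_ratio f n"
  by (simp add: gamma_ratio_def legendre_coeff_reflect cheb_coeff_reflect)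

section \<open>Coefficients as kernel integrals, and the case of powers\<close>

text \<open>With \<open>c = s = 1\<close> both weight factors are 1 on the open interval; the
  Jacobian 2 turns \<open>n + 1/2\<close> into \<open>2 * n + 1\<close>.\<close>

lemma legendre_coeff_jacobi_kernel:
  "legendre_coeff f n = of_nat (2 * n + 1) *
     (LINT t:{0..1}|lborel. f (1 - 2 * t) * jacobi_kernel 1 (\<lambda>t. legendreP n (1 - 2 * t)) 1 t)"
proof -
  have "(LINT t:{0..1}|lborel. f (1 - 2 * t) * complex_of_real (legendreP n (1 - 2 * t))) =
      (LINT t:{0..1}|lborel. f (1 - 2 * t) * jacobi_kernel 1 (\<lambda>t. legendreP n (1 - 2 * t)) 1 t)"
    by (rule set_integral_cong_01) (simp add: jacobi_kernel_def)
  then show ?thesis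
    unfolding legendre_coeff_def set_integral_subst_1_minus_2t by (simp add: algebra_simps)
qed

text \<open>Since \<open>1 - (1 - 2 * t)^2 = 4 * t * (1 - t)\<close>, the Jacobian 2 cancels against
  the square root and leaves the weight with \<open>c = s = 1/2\<close>.\<close>

lemma cheb_coeff_jacobi_kernel:
  "cheb_coeff f n = of_real (2 / pi) *
     (LINT t:{0..1}|lborel. f (1 - 2 * t) * jacobi_kernel (1/2) (\<lambda>t. chebyshevT n (1 - 2 * t)) (1/2) t)"
proof -
  have "2 * (f (1 - 2 * t) * complex_of_real (chebyshevT n (1 - 2 * t)) / complex_of_real (sqrt (1 - (1 - 2 * t)\<^sup>2))) =
      f (1 - 2 * t) * jacobi_kernel (1/2) (\<lambda>t. chebyshevT n (1 - 2 * t)) (1/2) t"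
    if t: "0 < t" "t < 1" for t
  proof -
    have "sqrt (1 - (1 - 2 * t)\<^sup>2) = sqrt (2\<^sup>2 * (t * (1 - t)))"
      by (rule arg_cong[of _ _ sqrt]) (simp add: power2_eq_square algebra_simps)
    also have "\<dots> = 2 * (sqrt t * sqrt (1 - t))"
      by (simp only: real_sqrt_mult) simp
    finally have "2 / sqrt (1 - (1 - 2 * t)\<^sup>2) = t powr (- (1/2)) * (1 - t) powr (- (1/2))"
      using t by (simp add: powr_minus powr_half_sqrt field_simps)
    moreover have "complex_of_real t powr (1/2 - 1) = of_real (t powr (- (1/2)))"
      using t powr_of_real[of t "- (1/2)"] by simp
    ultimately have "jacobi_kernel (1/2) (\<lambda>t. chebyshevT n (1 - 2 * t)) (1/2) t =
        of_real (2 / sqrt (1 - (1 - 2 * t)\<^sup>2)) * of_real (chebyshevT n (1 - 2 * t))"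
      by (simp add: jacobi_kernel_def)
    then show ?thesis by simp
  qed
  then have "(LINT t:{0..1}|lborel. 2 * (f (1 - 2 * t) * complex_of_real (chebyshevT n (1 - 2 * t)) /
        complex_of_real (sqrt (1 - (1 - 2 * t)\<^sup>2)))) =
      (LINT t:{0..1}|lborel. f (1 - 2 * t) * jacobi_kernel (1/2) (\<lambda>t. chebyshevT n (1 - 2 * t)) (1/2) t)"
    by (intro set_integral_cong_01) auto
  then show ?thesis
    unfolding cheb_coeff_def set_integral_subst_1_minus_2t set_integral_mult_right
    by (simp only:)
qed

text \<open>The power is that of \<open>2 * t\<close>: the part from 2 comes out as a constant and
  the part from \<open>t\<close> shifts \<open>s\<close> by \<alpha>. The base stays written as
  \<open>1 - (1 - 2 * t)\<close> to match \<open>f (1 - 2 * t)\<close> in the coefficient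
  formulas.\<close>

lemma integral_powr_jacobi_kernel:
  "(LINT t:{0..1}|lborel. complex_of_real (1 - (1 - 2 * t)) powr \<alpha> * jacobi_kernel c p s t) =
     2 powr \<alpha> * jacobi_integral c p (s + \<alpha>)"
proof -
  have "(LINT t:{0..1}|lborel. complex_of_real (1 - (1 - 2 * t)) powr \<alpha> * jacobi_kernel c p s t) =
      (LINT t:{0..1}|lborel. 2 powr \<alpha> * jacobi_kernel c p (s + \<alpha>) t)"
  proof (rule set_integral_cong_01)
    fix t :: real assume "0 < t"
    then have "complex_of_real (1 - (1 - 2 * t)) powr \<alpha> = 2 powr \<alpha> * exp (\<alpha> * of_real (ln t))"
      using powr_times_real[of 2 "of_real t" \<alpha>] by (simp add: powr_def[of "complex_of_real t"] Ln_of_real)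
    then show "complex_of_real (1 - (1 - 2 * t)) powr \<alpha> * jacobi_kernel c p s t =
        2 powr \<alpha> * jacobi_kernel c p (s + \<alpha>) t"
      using \<open>0 < t\<close> by (simp add: jacobi_kernel_add)
  qed
  then show ?thesis by (simp add: jacobi_integral_def)
qed

lemma jacobi_integral_chebyshevT_shifted:
  assumes "Re \<alpha> > -1/2"
  shows "jacobi_integral (1/2) (\<lambda>t. chebyshevT n (1 - 2 * t)) (1/2 + \<alpha>) =
     Beta (\<alpha> + 1/2) (1/2) * (pochhammer (- \<alpha>) n / pochhammer (\<alpha> + 1) n)"
  using jacobi_integral_chebyshevT[of "1/2 + \<alpha>" n] assms by (simp add: add_ac)

text \<open>The two coefficients share the factor \<open>2 powr \<alpha> * X / Y\<close>. What
  survives is the additional last factor \<open>of_nat n + \<alpha> + 1\<close> of the longer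
  Legendre denominator, the normalizing constants and the Gamma quotient inside
  \<open>b\<close>.\<close>

lemma gamma_ratio_powr:
  fixes \<alpha> :: complex
  assumes \<alpha>: "Re \<alpha> > -1/2" "\<alpha> \<notin> \<int>"
  defines "f \<equiv> \<lambda>x. complex_of_real (1 - x) powr \<alpha>"
  shows "cheb_coeff f n \<noteq> 0"
    and "gamma_ratio f n = Gamma (\<alpha> + 1) / Gamma (\<alpha> + 1/2) * of_real (sqrt pi) *
           ((of_nat n + 1/2) / (of_nat n + \<alpha> + 1))"
proof -
  define b where "b = Beta (\<alpha> + 1/2) (1/2)"
  define X Y where "X = pochhammer (- \<alpha>) n" and "Y = pochhammer (\<alpha> + 1) n"
  \<comment> \<open>\<open>pochhammer (- \<alpha>) n\<close> vanishes only if \<alpha> is one of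
    \<open>0, ..., n - 1\<close>, which is excluded for non-integers.\<close>
  have X: "X \<noteq> 0"
    using \<alpha> by (auto simp: X_def pochhammer_eq_0_iff)
  have Y: "Y \<noteq> 0"
    unfolding Y_def using \<alpha> by (intro pochhammer_nonzero) auto
  have G: "Gamma (\<alpha> + 1/2) \<noteq> 0" "Gamma (\<alpha> + 1) \<noteq> 0"
    using \<alpha> by (auto simp: Gamma_eq_zero_iff intro!: Re_pos_not_nonpos_Int)
  have b_eq: "b = Gamma (\<alpha> + 1/2) * of_real (sqrt pi) / Gamma (\<alpha> + 1)"
    by (simp add: b_def Beta_def Gamma_one_half_complex add.commute[of \<alpha> 1])
  have cheb: "cheb_coeff f n = of_real (2 / pi) * (2 powr \<alpha> * (b * (X / Y)))"
    using \<alpha> unfolding cheb_coeff_jacobi_kernel f_def integral_powr_jacobi_kernel b_def X_def Y_def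
    by (simp add: jacobi_integral_chebyshevT_shifted)
  show "cheb_coeff f n \<noteq> 0"
    unfolding cheb b_eq using X Y G by simp
  have leg: "legendre_coeff f n = of_nat (2 * n + 1) * (2 powr \<alpha> * (X / (Y * (of_nat n + \<alpha> + 1))))"
    using \<alpha> jacobi_integral_legendreP[of "1 + \<alpha>" n]
    unfolding legendre_coeff_jacobi_kernel f_def integral_powr_jacobi_kernel X_def Y_def
    by (simp add: pochhammer_Suc add_ac)
  \<comment> \<open>Written with \<open>sqrt pi\<close> twice, so that one copy cancels against the
    one in \<open>b\<close> and the other remains in the limit.\<close>
  have pi: "complex_of_real (2 / pi) = 2 / (of_real (sqrt pi) * of_real (sqrt pi))"
    by (simp flip: of_real_mult)
  have ratio: "M * (P * (X / (Y * D))) / (2 / (r * r) * (P * (g * r / h * (X / Y)))) = h / g * r * ((M / 2) / D)"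
    if "P \<noteq> 0" "D \<noteq> 0" "r \<noteq> 0" "g \<noteq> 0" "h \<noteq> 0" for M P D r g h :: complex
    using that X Y by (simp add: field_simps)
  have "of_nat n + \<alpha> + 1 \<noteq> 0"
    using \<alpha> by (auto simp: complex_eq_iff)
  then have nz: "2 powr \<alpha> \<noteq> 0" "of_nat n + \<alpha> + 1 \<noteq> 0" "complex_of_real (sqrt pi) \<noteq> 0"
    by simp_all
  have half: "of_nat (2 * n + 1) / 2 = of_nat n + (1/2 :: complex)"
    by (simp add: field_simps)
  show "gamma_ratio f n = Gamma (\<alpha> + 1) / Gamma (\<alpha> + 1/2) * of_real (sqrt pi) *
           ((of_nat n + 1/2) / (of_nat n + \<alpha> + 1))"
    unfolding gamma_ratio_def leg cheb b_eq pi ratio[OF nz G] half ..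
qed

section \<open>The case of logarithms\<close>

text \<open>Split \<open>ln (2 * t) = ln 2 + ln t\<close>. The first part gives a multiple of the
  integral at \<open>s0\<close>, which is 0 by the factor \<open>s0 - s\<close>; the second gives
  the derivative there, which is \<open>- H s0\<close>.\<close>

lemma integral_ln_jacobi_kernel:
  assumes c: "c > 0" and s0: "Re s0 > 0" and p: "continuous_on UNIV p"
    and H: "H holomorphic_on {s. Re s > 0}"
    and eq: "\<And>s. Re s > 0 \<Longrightarrow> jacobi_integral c p s = (s0 - s) * H s"
  shows "(LINT t:{0..1}|lborel. complex_of_real (ln (1 - (1 - 2 * t))) * jacobi_kernel c p s0 t) = - H s0"
proof -
  have op: "open {s. Re s > 0}" by (rule open_halfspace_Re_gt)
  have "isCont H s0"
    using holomorphic_on_imp_continuous_on[OF H] op s0 by (simp add: continuous_on_eq_continuous_at)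
  then have "((\<lambda>s. (s0 - s) * H s) has_field_derivative - H s0) (at s0)"
    \<comment> \<open>Caratheodory's criterion with slope function \<open>- H\<close>, which is
      continuous at \<open>s0\<close>.\<close>
    unfolding CARAT_DERIV by (intro exI[of _ "\<lambda>s. - H s"]) (auto simp: algebra_simps)
  then have "(jacobi_integral c p has_field_derivative - H s0) (at s0)"
    by (rule has_field_derivative_transform_within_open[OF _ op]) (use s0 eq in auto)
  with has_field_derivative_jacobi_integral[OF c s0 p]
  have deriv: "(LINT t:{0..1}|lborel. jacobi_kernel c p s0 t * of_real (ln t)) = - H s0"
    by (rule DERIV_unique)
  have "(LINT t:{0..1}|lborel. complex_of_real (ln (1 - (1 - 2 * t))) * jacobi_kernel c p s0 t) =
      (LINT t:{0..1}|lborel. of_real (ln 2) * jacobi_kernel c p s0 t + jacobi_kernel c p s0 t * of_real (ln t))"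
    by (rule set_integral_cong_01) (simp add: ln_mult algebra_simps)
  also have "\<dots> = of_real (ln 2) * jacobi_integral c p s0 - H s0"
    using set_integrable_jacobi_kernel[OF c s0 p] set_integrable_jacobi_kernel_ln[OF c s0 p]
    by (simp add: jacobi_integral_def deriv)
  finally show ?thesis using eq[OF s0] by simp
qed

lemma legendre_coeff_ln:
  "legendre_coeff (\<lambda>x. complex_of_real (ln (1 - x))) (Suc m) =
     - (of_nat (2 * m + 3) / (of_nat (Suc m) * of_nat (m + 2)))"
proof -
  \<comment> \<open>The closed form with the first factor \<open>1 - s\<close> of its numerator
    removed. That factor is present because the degree \<open>Suc m\<close> is positive.\<close>
  define H :: "complex \<Rightarrow> complex"
    where "H = (\<lambda>s. pochhammer (1 - s + 1) m / pochhammer s (Suc (Suc m)))"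
  have "(LINT t:{0..1}|lborel. complex_of_real (ln (1 - (1 - 2 * t))) *
      jacobi_kernel 1 (\<lambda>t. legendreP (Suc m) (1 - 2 * t)) 1 t) = - H 1"
  proof (rule integral_ln_jacobi_kernel)
    show "H holomorphic_on {s. Re s > 0}"
      unfolding H_def using pochhammer_nonzero by (intro holomorphic_intros) auto
    show "jacobi_integral 1 (\<lambda>t. legendreP (Suc m) (1 - 2 * t)) s = (1 - s) * H s" if "Re s > 0" for s
      using jacobi_integral_legendreP[OF that, of "Suc m"] by (simp add: H_def pochhammer_rec[of "1 - s"])
  qed (simp_all add: continuous_intros)
  \<comment> \<open>The quotient is \<open>m! / (m + 2)!\<close>.\<close>
  moreover have "H 1 = 1 / (of_nat (Suc m) * of_nat (m + 2))"
    by (simp add: H_def flip: pochhammer_fact)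
  ultimately show ?thesis
    unfolding legendre_coeff_jacobi_kernel by simp
qed

lemma cheb_coeff_ln:
  "cheb_coeff (\<lambda>x. complex_of_real (ln (1 - x))) (Suc m) = - (2 / of_nat (Suc m))"
proof -
  define H :: "complex \<Rightarrow> complex"
    where "H = (\<lambda>s. Beta s (1/2) * (pochhammer (1/2 - s + 1) m / pochhammer (s + 1/2) (Suc m)))"
  have "(LINT t:{0..1}|lborel. complex_of_real (ln (1 - (1 - 2 * t))) *
      jacobi_kernel (1/2) (\<lambda>t. chebyshevT (Suc m) (1 - 2 * t)) (1/2) t) = - H (1/2)"
  proof (rule integral_ln_jacobi_kernel)
    show "H holomorphic_on {s. Re s > 0}"
      unfolding H_def using pochhammer_nonzero Re_pos_not_nonpos_Int
      by (intro holomorphic_intros) auto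
    show "jacobi_integral (1/2) (\<lambda>t. chebyshevT (Suc m) (1 - 2 * t)) s = (1/2 - s) * H s" if "Re s > 0" for s
      using jacobi_integral_chebyshevT[OF that, of "Suc m"] by (simp add: H_def pochhammer_rec[of "1/2 - s"])
  qed (simp_all add: continuous_intros)
  \<comment> \<open>This is the square of \<open>Gamma (1/2)\<close> over \<open>Gamma 1\<close>;
    the Pochhammer quotient at \<open>s = 1/2\<close> is \<open>m! / (m + 1)!\<close>.\<close>
  moreover have "Beta (1/2) (1/2) = complex_of_real pi"
    by (simp add: Beta_def Gamma_one_half_complex flip: of_real_mult)
  then have "H (1/2) = pi / of_nat (Suc m)"
    by (simp add: H_def flip: pochhammer_fact)
  ultimately show ?thesis
    unfolding cheb_coeff_jacobi_kernel by simp
qed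

lemma gamma_ratio_ln:
  assumes "n > 0"
  shows "gamma_ratio (\<lambda>x. complex_of_real (ln (1 - x))) n = (of_nat n + 1/2) / (of_nat n + 1)"
proof -
  obtain m where n: "n = Suc m" using assms gr0_implies_Suc by blast
  have "gamma_ratio (\<lambda>x. complex_of_real (ln (1 - x))) n =
      of_nat (2 * m + 3) / (of_nat (Suc m) * of_nat (m + 2)) / (2 / of_nat (Suc m))"
    unfolding n gamma_ratio_def legendre_coeff_ln cheb_coeff_ln by simp
  also have "\<dots> = (of_nat (2 * m + 3) / 2) / of_nat (m + 2)"
    by (simp del: of_nat_Suc of_nat_add of_nat_mult)
  also have "\<dots> = (of_nat n + 1/2) / (of_nat n + 1)"
    by (simp add: n field_simps)
  finally show ?thesis .
qed

section \<open>The error term and the asymptotic statements\<close>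

text \<open>The difference equals \<open>- L * (\<alpha> + 1/2) / (of_nat n + \<alpha> + 1)\<close>,
  and the bound on \<open>Re \<alpha>\<close> makes the denominator at least \<open>n\<close> in
  norm.\<close>

lemma ratio_minus_limit_bigo:
  fixes \<alpha> L :: complex
  assumes "Re \<alpha> > -1/2"
  shows "(\<lambda>n. L * ((of_nat n + 1/2) / (of_nat n + \<alpha> + 1)) - L) \<in> O(\<lambda>n. 1 / of_nat n)"
proof (rule bigoI)
  show "\<forall>\<^sub>F n in sequentially. norm (L * ((of_nat n + 1/2) / (of_nat n + \<alpha> + 1)) - L) \<le>
      norm (L * (\<alpha> + 1/2)) * norm (1 / of_nat n :: complex)"
    using eventually_gt_at_top[of 0]
  proof eventually_elim
    case (elim n)
    have "real n \<le> Re (of_nat n + \<alpha> + 1)" using assms by simp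
    also have "\<dots> \<le> norm (of_nat n + \<alpha> + 1)" by (rule complex_Re_le_cmod)
    finally have n: "real n \<le> norm (of_nat n + \<alpha> + 1)" .
    then have "of_nat n + \<alpha> + 1 \<noteq> 0" using elim by auto
    then have "L * ((of_nat n + 1/2) / (of_nat n + \<alpha> + 1)) - L =
        (L * (of_nat n + 1/2) - L * (of_nat n + \<alpha> + 1)) / (of_nat n + \<alpha> + 1)"
      by (simp add: diff_divide_distrib)
    also have "L * (of_nat n + 1/2) - L * (of_nat n + \<alpha> + 1) = - (L * (\<alpha> + 1/2))"
      by (simp add: algebra_simps)
    finally have "norm (L * ((of_nat n + 1/2) / (of_nat n + \<alpha> + 1)) - L) =
        norm (L * (\<alpha> + 1/2)) / norm (of_nat n + \<alpha> + 1)"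
      by (simp only: norm_divide norm_minus_cancel)
    also have "\<dots> \<le> norm (L * (\<alpha> + 1/2)) / real n"
      using n elim by (intro divide_left_mono mult_pos_pos) auto
    finally show ?case by (simp add: norm_divide)
  qed
qed

theorem theorem5p5:
  shows
  "(\<forall>\<alpha>::complex. Re \<alpha> > -1/2 \<and> \<alpha> \<notin> \<int> \<longrightarrow>
      (\<forall>f \<in> {\<lambda>x. complex_of_real (1 + x) powr \<alpha>, \<lambda>x. complex_of_real (1 - x) powr \<alpha>}.
         (\<forall>\<^sub>F n in sequentially. cheb_coeff f n \<noteq> 0) \<and>
         (\<lambda>n. gamma_ratio f n - Gamma (\<alpha> + 1) / Gamma (\<alpha> + 1/2) * complex_of_real (sqrt pi))
           \<in> O(\<lambda>n. 1 / of_nat n)))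
   \<and>
   (\<forall>f \<in> {\<lambda>x. complex_of_real (ln (1 + x)), \<lambda>x. complex_of_real (ln (1 - x))}.
         (\<forall>\<^sub>F n in sequentially. cheb_coeff f n \<noteq> 0) \<and>
         (\<lambda>n. gamma_ratio f n - 1) \<in> O(\<lambda>n. 1 / of_nat n))"
proof -
  \<comment> \<open>Each set of functions in the claim has the form
    \<open>{\<lambda>x. g (- x), g}\<close> with \<open>g\<close> a function of
    \<open>1 - x\<close>, so it suffices to treat \<open>g\<close>.\<close>
  have reflect: "(\<forall>\<^sub>F n in sequentially. cheb_coeff f n \<noteq> 0) \<and> (\<lambda>n. gamma_ratio f n - L) \<in> O(\<lambda>n. 1 / of_nat n)"
    if "f \<in> {\<lambda>x. g (- x), g}" "\<forall>\<^sub>F n in sequentially. cheb_coeff g n \<noteq> 0"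
      "(\<lambda>n. gamma_ratio g n - L) \<in> O(\<lambda>n. 1 / of_nat n)" for f g and L :: complex
    using that by (auto simp: gamma_ratio_reflect cheb_coeff_reflect)
  show ?thesis
  proof (intro conjI[of "All _"] allI impI ballI)
    fix \<alpha> :: complex and f
    assume \<alpha>: "Re \<alpha> > -1/2 \<and> \<alpha> \<notin> \<int>"
      and f: "f \<in> {\<lambda>x. complex_of_real (1 + x) powr \<alpha>, \<lambda>x. complex_of_real (1 - x) powr \<alpha>}"
    define g where "g = (\<lambda>x. complex_of_real (1 - x) powr \<alpha>)"
    show "(\<forall>\<^sub>F n in sequentially. cheb_coeff f n \<noteq> 0) \<and>
        (\<lambda>n. gamma_ratio f n - Gamma (\<alpha> + 1) / Gamma (\<alpha> + 1/2) * complex_of_real (sqrt pi))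
          \<in> O(\<lambda>n. 1 / of_nat n)"
    proof (rule reflect)
      show "f \<in> {\<lambda>x. g (- x), g}" using f by (simp add: g_def)
      show "\<forall>\<^sub>F n in sequentially. cheb_coeff g n \<noteq> 0"
        unfolding g_def using \<alpha> by (intro always_eventually allI gamma_ratio_powr(1)) auto
      show "(\<lambda>n. gamma_ratio g n - Gamma (\<alpha> + 1) / Gamma (\<alpha> + 1/2) * complex_of_real (sqrt pi))
          \<in> O(\<lambda>n. 1 / of_nat n)"
        unfolding g_def using \<alpha>
        by (subst gamma_ratio_powr(2)) (auto simp only: intro!: ratio_minus_limit_bigo)
    qed
  next
    fix f
    assume f: "f \<in> {\<lambda>x. complex_of_real (ln (1 + x)), \<lambda>x. complex_of_real (ln (1 - x))}"
    define g where "g = (\<lambda>x. complex_of_real (ln (1 - x)))"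
    \<comment> \<open>Degree 0 is set aside: the logarithmic formulas rest on the zero that appears
      only in positive degree.\<close>
    have pos: "\<forall>\<^sub>F n in sequentially. n > (0 :: nat)"
      by (rule eventually_gt_at_top)
    show "(\<forall>\<^sub>F n in sequentially. cheb_coeff f n \<noteq> 0) \<and>
        (\<lambda>n. gamma_ratio f n - 1) \<in> O(\<lambda>n. 1 / of_nat n)"
    proof (rule reflect)
      show "f \<in> {\<lambda>x. g (- x), g}" using f by (simp add: g_def)
      show "\<forall>\<^sub>F n in sequentially. cheb_coeff g n \<noteq> 0"
        using pos
      proof eventually_elim
        case (elim n)
        then show ?case
          by (cases n) (simp_all add: g_def cheb_coeff_ln del: of_nat_Suc)
      qed
      \<comment> \<open>The right-hand side is spelled out as the instance \<alpha> = 0,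
        \<open>L = 1\<close> of the error estimate.\<close>
      have "\<forall>\<^sub>F n in sequentially. gamma_ratio g n - 1 = 1 * ((of_nat n + 1/2) / (of_nat n + 0 + 1)) - 1"
        using pos by eventually_elim (simp add: g_def gamma_ratio_ln)
      then show "(\<lambda>n. gamma_ratio g n - 1) \<in> O(\<lambda>n. 1 / of_nat n)"
        using ratio_minus_limit_bigo[of 0 1] by (subst landau_o.big.in_cong) auto
    qed
  qed
qed

end
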